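(* Define sequences of natural numbers by $a_0=3$, $b_0=4$, $c_0=a_0+b_0=7$ and, for all $i\ge 0$, $a_{i+1}=c_i$, $b_{i+1}=c_i+1$, $c_{i+1}=2c_i+1$. Let $\mathcal{D}^C$ be the structure with domain $T^C\cup\mathcal{A}^C$, where $T^C=\{a_i\mid i\in\mathbb{N}\}$ and $\mathcal{A}^C=\{b_i\mid i\in\mathbb{N}\}$, whose relations interpreting $T,S,A,D,N,P$ are respectively $T^C$ and $$S^C=\{(c_i,a_i,b_i)\mid i\in\mathbb{N}\}\cup\{(c_i,b_i,a_i)\mid i\in\mathbb{N}\},\qquad A^C=\{(b_i,a_i)\mid i\in\mathbb{N}\},$$ $$D^C=\{(c_i,b_i)\mid i\in\mathbb{N}\}\cup\{(c_i,a_i)\mid i\in\mathbb{N}\},\qquad N^C=\{c_i\mid i\in\mathbb{N}\}=\{a_{i+1}\mid i\in\mathbb{N}\},$$ $$P^C=\{(x,y)\mid x,y\in T^C\cup\mathcal{A}^C,\ x<y\}.$$ Then $\mathcal{D}^C$ is a model for each of the schemes $TAS_1$, $TAS_2$ and $TAS_3$.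
   Context: $\mathbb{N}$ includes $0$. The schemes are sets of axioms in first-order logic with equality, with unary predicates $T,N$, binary predicates $A,D,P$ and a ternary predicate $S$. A relation interprets a predicate in the obvious way: $A(y,x)$ holds iff $(y,x)$ is in the relation interpreting $A$, and $S(z,x,y)$ holds iff $(z,x,y)$ is in the relation interpreting $S$, etc. All quantifiers range over the domain. $N$ is a defined predicate: $N(z)$ abbreviates $\exists x\exists y[S(z,x,y)\land D(z,x)\land D(z,y)]$. In a model, the relation listed for $N$ must coincide with this defined predicate. $TAS_1$ consists of the axioms: E1: $\exists x[T(x)]$. E2: $\forall x[T(x)\to\exists!\,y[A(y,x)]]$. E3: $\forall x\forall y[A(y,x)\to\exists!\,z[S(z,x,y)]]$. R1: $\forall x\forall y[A(y,x)\to[T(x)\land\neg A(x,y)]]$. R2: $\forall x\forall y\forall z[S(z,x,y)\to[T(z)\land[A(x,y)\lor A(y,x)]\land\neg[S(x,z,y)\lor S(y,x,z)]]]$. $TAS_2$ consists of E1, E2, E3, R1, R2 together with: E4: $\exists x[N(x)]$. E5: $\forall x[N(x)\to\exists y[N(y)\land y\neq x]]$. $TAS_3$ consists of E1, E2, E3, E4 together with: E5.1: $\forall x[N(x)\to\exists y[N(y)\land P(x,y)]]$. E6.1: $\forall x\exists y[P(x,y)]$. R1.1: $\forall x\forall y[A(y,x)\to[T(x)\land P(x,y)]]$. R2.1: $\forall x\forall y\forall z[S(z,x,y)\to[T(z)\land[A(x,y)\lor A(y,x)]\land S(z,y,x)\land P(x,z)\land P(y,z)]]$. R3.1: $\forall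 x\forall y[P(x,y)\to\neg P(y,x)]$. R4.1: $\forall x\forall y\forall z[[P(x,y)\land P(y,z)]\to P(x,z)]$. *)

theory Defs
  imports Main
begin

text \<open>First-order formulas with equality over the signature $T, N$ (unary), $A, D, P$ (binary),
  $S$ (ternary). There are no function symbols, so terms are variables, named by natural numbers.
  The symbol $N$ belongs to the signature; that it abbreviates a formula is imposed on models below.\<close>

datatype fm =
    EqF nat nat  (infix "\<^bold>=" 50)
  | TF nat
  | NF nat
  | AF nat nat
  | DF nat nat
  | PF nat nat
  | SF nat nat nat
  | Neg fm  ("\<^bold>\<not>_" [40] 40)
  | Conj fm fm  (infixr "\<^bold>\<and>" 35)
  | Disj fm fm  (infixr "\<^bold>\<or>" 30)
  | Imp fm fm  (infixr "\<^bold>\<longrightarrow>" 25)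
  | Iff fm fm  (infixr "\<^bold>\<longleftrightarrow>" 25)
  | All nat fm  ("(\<^bold>\<forall>_./ _)" [0, 10] 10)
  | Exi nat fm  ("(\<^bold>\<exists>_./ _)" [0, 10] 10)
  | Exi1 nat fm  ("(\<^bold>\<exists>!_./ _)" [0, 10] 10)

abbreviation vx :: nat where "vx \<equiv> 0"
abbreviation vy :: nat where "vy \<equiv> 1"
abbreviation vz :: nat where "vz \<equiv> 2"

record 'a interp =
  domain :: "'a set"
  relT :: "'a set"
  relS :: "('a \<times> 'a \<times> 'a) set"
  relA :: "('a \<times> 'a) set"
  relD :: "('a \<times> 'a) set"
  relN :: "'a set"
  relP :: "('a \<times> 'a) set"

definition is_structure :: "'a interp \<Rightarrow> bool" where
  "is_structure M \<longleftrightarrow>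
     domain M \<noteq> {} \<and>
     relT M \<subseteq> domain M \<and>
     relS M \<subseteq> domain M \<times> domain M \<times> domain M \<and>
     relA M \<subseteq> domain M \<times> domain M \<and>
     relD M \<subseteq> domain M \<times> domain M \<and>
     relN M \<subseteq> domain M \<and>
     relP M \<subseteq> domain M \<times> domain M"

primrec sat :: "'a interp \<Rightarrow> (nat \<Rightarrow> 'a) \<Rightarrow> fm \<Rightarrow> bool" where
  "sat M e (v \<^bold>= w) \<longleftrightarrow> e v = e w"
| "sat M e (TF v) \<longleftrightarrow> e v \<in> relT M"
| "sat M e (NF v) \<longleftrightarrow> e v \<in> relN M"
| "sat M e (AF v w) \<longleftrightarrow> (e v, e w) \<in> relA M"
| "sat M e (DF v w) \<longleftrightarrow> (e v, e w) \<in> relD M"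
| "sat M e (PF v w) \<longleftrightarrow> (e v, e w) \<in> relP M"
| "sat M e (SF u v w) \<longleftrightarrow> (e u, e v, e w) \<in> relS M"
| "sat M e (\<^bold>\<not>\<phi>) \<longleftrightarrow> \<not> sat M e \<phi>"
| "sat M e (\<phi> \<^bold>\<and> \<psi>) \<longleftrightarrow> sat M e \<phi> \<and> sat M e \<psi>"
| "sat M e (\<phi> \<^bold>\<or> \<psi>) \<longleftrightarrow> sat M e \<phi> \<or> sat M e \<psi>"
| "sat M e (\<phi> \<^bold>\<longrightarrow> \<psi>) \<longleftrightarrow> (sat M e \<phi> \<longrightarrow> sat M e \<psi>)"
| "sat M e (\<phi> \<^bold>\<longleftrightarrow> \<psi>) \<longleftrightarrow> (sat M e \<phi> \<longleftrightarrow> sat M e \<psi>)"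
| "sat M e (\<^bold>\<forall>v. \<phi>) \<longleftrightarrow> (\<forall>d\<in>domain M. sat M (e(v := d)) \<phi>)"
| "sat M e (\<^bold>\<exists>v. \<phi>) \<longleftrightarrow> (\<exists>d\<in>domain M. sat M (e(v := d)) \<phi>)"
| "sat M e (\<^bold>\<exists>!v. \<phi>) \<longleftrightarrow> (\<exists>!d. d \<in> domain M \<and> sat M (e(v := d)) \<phi>)"

definition holds_in :: "'a interp \<Rightarrow> fm \<Rightarrow> bool" where
  "holds_in M \<phi> \<longleftrightarrow> (\<forall>e. range e \<subseteq> domain M \<longrightarrow> sat M e \<phi>)"

definition N_definition :: fm where
  "N_definition =
     (\<^bold>\<forall>vz. NF vz \<^bold>\<longleftrightarrow> (\<^bold>\<exists>vx. \<^bold>\<exists>vy. SF vz vx vy \<^bold>\<and> DF vz vx \<^bold>\<and> DF vz vy))"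

text \<open>In a model of any set of axioms, the relation listed for $N$ has to coincide with the
  predicate that $N$ abbreviates.\<close>

definition is_model :: "'a interp \<Rightarrow> fm set \<Rightarrow> bool" where
  "is_model M \<Gamma> \<longleftrightarrow> is_structure M \<and> holds_in M N_definition \<and> (\<forall>\<phi>\<in>\<Gamma>. holds_in M \<phi>)"

definition ax_E1 :: fm where
  "ax_E1 = (\<^bold>\<exists>vx. TF vx)"

definition ax_E2 :: fm where
  "ax_E2 = (\<^bold>\<forall>vx. TF vx \<^bold>\<longrightarrow> (\<^bold>\<exists>!vy. AF vy vx))"

definition ax_E3 :: fm where
  "ax_E3 = (\<^bold>\<forall>vx. \<^bold>\<forall>vy. AF vy vx \<^bold>\<longrightarrow> (\<^bold>\<exists>!vz. SF vz vx vy))"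

definition ax_E4 :: fm where
  "ax_E4 = (\<^bold>\<exists>vx. NF vx)"

definition ax_E5 :: fm where
  "ax_E5 = (\<^bold>\<forall>vx. NF vx \<^bold>\<longrightarrow> (\<^bold>\<exists>vy. NF vy \<^bold>\<and> \<^bold>\<not>(vy \<^bold>= vx)))"

definition ax_E5_1 :: fm where
  "ax_E5_1 = (\<^bold>\<forall>vx. NF vx \<^bold>\<longrightarrow> (\<^bold>\<exists>vy. NF vy \<^bold>\<and> PF vx vy))"

definition ax_E6_1 :: fm where
  "ax_E6_1 = (\<^bold>\<forall>vx. \<^bold>\<exists>vy. PF vx vy)"

definition ax_R1 :: fm where
  "ax_R1 = (\<^bold>\<forall>vx. \<^bold>\<forall>vy. AF vy vx \<^bold>\<longrightarrow> TF vx \<^bold>\<and> \<^bold>\<not>(AF vx vy))"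

definition ax_R2 :: fm where
  "ax_R2 = (\<^bold>\<forall>vx. \<^bold>\<forall>vy. \<^bold>\<forall>vz. SF vz vx vy \<^bold>\<longrightarrow>
     TF vz \<^bold>\<and> (AF vx vy \<^bold>\<or> AF vy vx) \<^bold>\<and> \<^bold>\<not>(SF vx vz vy \<^bold>\<or> SF vy vx vz))"

definition ax_R1_1 :: fm where
  "ax_R1_1 = (\<^bold>\<forall>vx. \<^bold>\<forall>vy. AF vy vx \<^bold>\<longrightarrow> TF vx \<^bold>\<and> PF vx vy)"

definition ax_R2_1 :: fm where
  "ax_R2_1 = (\<^bold>\<forall>vx. \<^bold>\<forall>vy. \<^bold>\<forall>vz. SF vz vx vy \<^bold>\<longrightarrow>
     TF vz \<^bold>\<and> (AF vx vy \<^bold>\<or> AF vy vx) \<^bold>\<and> SF vz vy vx \<^bold>\<and> PF vx vz \<^bold>\<and> PF vy vz)"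

definition ax_R3_1 :: fm where
  "ax_R3_1 = (\<^bold>\<forall>vx. \<^bold>\<forall>vy. PF vx vy \<^bold>\<longrightarrow> \<^bold>\<not>(PF vy vx))"

definition ax_R4_1 :: fm where
  "ax_R4_1 = (\<^bold>\<forall>vx. \<^bold>\<forall>vy. \<^bold>\<forall>vz. PF vx vy \<^bold>\<and> PF vy vz \<^bold>\<longrightarrow> PF vx vz)"

definition TAS1 :: "fm set" where
  "TAS1 = {ax_E1, ax_E2, ax_E3, ax_R1, ax_R2}"

definition TAS2 :: "fm set" where
  "TAS2 = TAS1 \<union> {ax_E4, ax_E5}"

definition TAS3 :: "fm set" where
  "TAS3 = {ax_E1, ax_E2, ax_E3, ax_E4, ax_E5_1, ax_E6_1, ax_R1_1, ax_R2_1, ax_R3_1, ax_R4_1}"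

function a_seq :: "nat \<Rightarrow> nat" and b_seq :: "nat \<Rightarrow> nat" and c_seq :: "nat \<Rightarrow> nat" where
  "a_seq 0 = 3"
| "a_seq (Suc i) = c_seq i"
| "b_seq 0 = 4"
| "b_seq (Suc i) = c_seq i + 1"
| "c_seq 0 = a_seq 0 + b_seq 0"
| "c_seq (Suc i) = 2 * c_seq i + 1"
  by pat_completeness auto
termination
  by (relation "measure (case_sum (\<lambda>i. 2 * i) (case_sum (\<lambda>i. 2 * i) (\<lambda>i. 2 * i + 1)))") auto

lemma c_seq_0: "c_seq 0 = 7"
  by simp

definition T_C :: "nat set" where
  "T_C = {a_seq i | i. True}"

definition cA_C :: "nat set" where
  "cA_C = {b_seq i | i. True}"

definition D_C :: "nat interp" where
  "D_C = \<lparr>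
     domain = T_C \<union> cA_C,
     relT = T_C,
     relS = {(c_seq i, a_seq i, b_seq i) | i. True} \<union> {(c_seq i, b_seq i, a_seq i) | i. True},
     relA = {(b_seq i, a_seq i) | i. True},
     relD = {(c_seq i, b_seq i) | i. True} \<union> {(c_seq i, a_seq i) | i. True},
     relN = {c_seq i | i. True},
     relP = {(x, y). x \<in> T_C \<union> cA_C \<and> y \<in> T_C \<union> cA_C \<and> x < y}\<rparr>"

end

theory Submission
  imports Defs
begin

text \<open>Everything is determined by the sequence $a$: one has $b_i = a_i + 1$ and
  $c_i = 2 a_i + 1 = a_{i+1}$. Every $a_i$ is odd and every $b_i$ is even, so $T^C$ and
  $\mathcal{A}^C$ are disjoint. The sequence $a$ is strictly increasing, hence injective, which
  makes the witnesses in E2 and E3 unique. In R2, a triple of $S^C$ with its first entry swapped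
  out could only lie in $S^C$ with the same index, which $a_i, b_i < c_i$ excludes.\<close>

lemma b_seq_eq: "b_seq i = a_seq i + 1"
  by (cases i) auto

text \<open>A case split replaces induction: at 0 this is 3 + 4 = 2 * 3 + 1, and at a successor
  \<open>a_seq (Suc i)\<close> is \<open>c_seq i\<close>, so it is the recursion for
  \<open>c_seq\<close>.\<close>

lemma c_seq_eq: "c_seq i = 2 * a_seq i + 1"
  by (cases i) auto

lemma odd_a_seq: "odd (a_seq i)"
  by (cases i) (auto simp: c_seq_eq)

lemma a_seq_less_Suc: "a_seq i < a_seq (Suc i)"
  by (simp add: c_seq_eq)

lemma inj_a_seq: "inj a_seq"
  by (intro strict_mono_imp_inj_on)
    (use a_seq_less_Suc in \<open>auto simp: strict_mono_Suc_iff simp del: a_seq.simps\<close>)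

lemma a_seq_eq_iff [simp]: "a_seq i = a_seq j \<longleftrightarrow> i = j"
  using inj_a_seq by (auto dest: injD)

lemma b_seq_eq_iff [simp]: "b_seq i = b_seq j \<longleftrightarrow> i = j"
  by (simp add: b_seq_eq)

lemma c_seq_eq_iff [simp]: "c_seq i = c_seq j \<longleftrightarrow> i = j"
  by (simp add: c_seq_eq)

lemma a_seq_neq_b_seq [simp]: "a_seq i \<noteq> b_seq j" "b_seq j \<noteq> a_seq i"
  using odd_a_seq[of i] odd_a_seq[of j] by (metis b_seq_eq even_plus_one_iff)+

lemma b_seq_neq_c_seq [simp]: "b_seq i \<noteq> c_seq j" "c_seq j \<noteq> b_seq i"
  using a_seq_neq_b_seq[of "Suc j" i] by auto

lemma a_seq_less_b_seq: "a_seq i < b_seq i"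
  by (simp add: b_seq_eq)

lemma a_seq_less_c_seq: "a_seq i < c_seq i"
  by (simp add: c_seq_eq)

text \<open>Restricted to equal indices, since \<open>a_seq (Suc i) = c_seq i\<close>.\<close>

lemma a_seq_neq_c_seq [simp]: "a_seq i \<noteq> c_seq i" "c_seq i \<noteq> a_seq i"
  using a_seq_less_c_seq[of i] by auto

lemma b_seq_less_c_seq: "b_seq i < c_seq i"
  \<comment> \<open>In terms of a the claim reads a + 1 < 2a + 1; oddness supplies a > 0.\<close>
  using odd_pos[OF odd_a_seq] by (simp add: b_seq_eq c_seq_eq)

lemma a_seq_mem: "a_seq i \<in> T_C"
  by (auto simp: T_C_def)

lemma b_seq_mem: "b_seq i \<in> cA_C"
  by (auto simp: cA_C_def)

lemma c_seq_mem: "c_seq i \<in> T_C"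
  using a_seq_mem[of "Suc i"] by simp

lemmas D_C_simps = D_C_def holds_in_def a_seq_mem b_seq_mem c_seq_mem
  a_seq_less_b_seq a_seq_less_c_seq b_seq_less_c_seq

lemma D_C_structure: "is_structure D_C"
  by (auto simp: is_structure_def D_C_simps)
    (use a_seq_mem in blast)

text \<open>Each triple in \<open>relS\<close> starts with some \<open>c_seq i\<close>, which
  \<open>relD\<close> relates to both other entries; conversely \<open>a_seq i\<close> and
  \<open>b_seq i\<close> are witnesses for \<open>c_seq i\<close>.\<close>

lemma D_C_N_definition: "holds_in D_C N_definition"
  by (auto simp: N_definition_def D_C_simps) (metis a_seq_mem b_seq_mem UnCI)+

lemma D_C_E1: "holds_in D_C ax_E1"
  using a_seq_mem by (simp add: ax_E1_def D_C_def holds_in_def) blast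

lemma D_C_E2: "holds_in D_C ax_E2"
  by (auto simp: ax_E2_def D_C_simps T_C_def cA_C_def)

text \<open>The mirrored triples of \<open>relS\<close> yield no second z, because no
  \<open>a_seq\<close> value is a \<open>b_seq\<close> value.\<close>

lemma D_C_E3: "holds_in D_C ax_E3"
  by (auto simp: ax_E3_def D_C_simps)

lemma D_C_E4: "holds_in D_C ax_E4"
  using c_seq_mem by (simp add: ax_E4_def D_C_def holds_in_def) blast

text \<open>The successor term serves both E5 and E5.1; the bounded quantifier matches the unfolded
  \<open>sat\<close>.\<close>

lemma ex_larger_c_seq: "\<exists>d\<in>T_C \<union> cA_C. (\<exists>j. d = c_seq j) \<and> c_seq i < d"
proof
  show "(\<exists>j. c_seq (Suc i) = c_seq j) \<and> c_seq i < c_seq (Suc i)"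
    by (intro conjI exI[of _ "Suc i"]) auto
  show "c_seq (Suc i) \<in> T_C \<union> cA_C"
    using c_seq_mem by blast
qed

lemma D_C_E5: "holds_in D_C ax_E5"
proof -
  have "\<exists>d\<in>T_C \<union> cA_C. (\<exists>j. d = c_seq j) \<and> d \<noteq> c_seq i" for i
    using ex_larger_c_seq[of i] by (metis less_irrefl)
  then show ?thesis
    by (simp add: ax_E5_def D_C_def holds_in_def) blast
qed

lemma D_C_E5_1: "holds_in D_C ax_E5_1"
  using ex_larger_c_seq by (simp add: ax_E5_1_def D_C_def holds_in_def) blast

lemma D_C_E6_1: "holds_in D_C ax_E6_1"
proof -
  have "\<exists>y\<in>T_C \<union> cA_C. x < y" if "x \<in> T_C \<union> cA_C" for x
    using that a_seq_less_c_seq b_seq_less_c_seq c_seq_mem by (fastforce simp: T_C_def cA_C_def)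
  then show ?thesis
    by (auto simp: ax_E6_1_def D_C_def holds_in_def)
qed

lemma D_C_R1: "holds_in D_C ax_R1"
  by (auto simp: ax_R1_def D_C_simps)

lemma D_C_R2: "holds_in D_C ax_R2"
  by (auto simp: ax_R2_def D_C_simps)

lemma D_C_R1_1: "holds_in D_C ax_R1_1"
  by (auto simp: ax_R1_1_def D_C_simps)

lemma D_C_R2_1: "holds_in D_C ax_R2_1"
  by (auto simp: ax_R2_1_def D_C_simps)

lemma D_C_R3_1: "holds_in D_C ax_R3_1"
  by (auto simp: ax_R3_1_def D_C_def holds_in_def)

lemma D_C_R4_1: "holds_in D_C ax_R4_1"
  by (auto simp: ax_R4_1_def D_C_def holds_in_def)

theorem theorem2p7:
  shows "relN D_C = {a_seq (Suc i) | i. True} \<and>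
    is_model D_C TAS1 \<and> is_model D_C TAS2 \<and> is_model D_C TAS3"
  \<comment> \<open>Only \<open>relN D_C\<close> is unfolded; elsewhere \<open>D_C\<close> stays
    folded so that the lemmas on single axioms apply.\<close>
  by (auto simp: D_C_def[THEN arg_cong[of _ _ relN]] is_model_def TAS1_def TAS2_def TAS3_def
      D_C_structure D_C_N_definition D_C_E1 D_C_E2 D_C_E3 D_C_E4 D_C_E5 D_C_E5_1 D_C_E6_1
      D_C_R1 D_C_R2 D_C_R1_1 D_C_R2_1 D_C_R3_1 D_C_R4_1)

end
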